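(* For all $n\geq0$ and $\sigma\in\{231,312\}$, $j_n(\{123,\sigma\})=1+\left\lfloor\frac{(n-1)^2}{4}\right\rfloor$.
   Context: A permutation of a finite set $S$ of positive integers is a word in which each element of $S$ appears exactly once; $\mathfrak{S}_n$ is the set of permutations of $\{1,\dots,n\}$. For a permutation $\pi$ and a letter $x$ of $\pi$, $\rho_\pi(x)$ is the maximal consecutive subword of $\pi$ consisting of the letters immediately to the right of $x$ that are all larger than $x$. $\pi$ is Jacobi if $|\rho_\pi(x)|$ is even for all letters $x$. A permutation $\pi$ avoids a pattern $\sigma$ if no subword of $\pi$ has standardization (relative order) $\sigma$. For a set $\Pi$ of patterns, $j_n(\Pi)$ is the number of Jacobi permutations in $\mathfrak{S}_n$ avoiding every pattern in $\Pi$. *)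

theory Defs
  imports Complex_Main "HOL-Library.Sublist" "HOL-Combinatorics.Multiset_Permutations"
begin

text \<open>
  Permutations of a finite set of positive integers are words, i.e. the elements of
  \<^const>\<open>permutations_of_set\<close>; patterns are words such as \<^term>\<open>[2, 3, 1 :: nat]\<close>.
\<close>

definition rho :: "nat list \<Rightarrow> nat \<Rightarrow> nat list" where
  "rho \<pi> x = takeWhile (\<lambda>y. x < y) (tl (dropWhile (\<lambda>y. y \<noteq> x) \<pi>))"

definition jacobi :: "nat list \<Rightarrow> bool" where
  "jacobi \<pi> \<longleftrightarrow> (\<forall>x \<in> set \<pi>. even (length (rho \<pi> x)))"

text \<open>For words with distinct letters: the \<open>i\<close>-th smallest letter is replaced by \<open>i\<close>.\<close>

definition standardization :: "nat list \<Rightarrow> nat list" where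
  "standardization w = map (\<lambda>x. card {y \<in> set w. y \<le> x}) w"

text \<open>Subwords in the sense of pattern containment need not be consecutive.\<close>

definition avoids :: "nat list \<Rightarrow> nat list \<Rightarrow> bool" where
  "avoids \<pi> \<sigma> \<longleftrightarrow> \<not> (\<exists>w. subseq w \<pi> \<and> standardization w = \<sigma>)"

definition jacobi_count :: "nat \<Rightarrow> nat list set \<Rightarrow> nat" where
  "jacobi_count n P =
     card {\<pi> \<in> permutations_of_set {1..n}. jacobi \<pi> \<and> (\<forall>\<sigma> \<in> P. avoids \<pi> \<sigma>)}"

end

theory Submission
  imports Defs
begin

text \<open>
  Call a word \<open>x \<dots> 1 n \<dots> x+1\<close> with \<open>1 \<le> x < n\<close> a block permutation; it is
  Jacobi iff \<open>n - x\<close> is even. A \<open>{123, 231}\<close>-avoider that does not start with its maximum is a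
  block permutation, and so is a \<open>{123, 312}\<close>-avoider that does not end with its minimum. Since
  prepending a new maximum (appending a new minimum) preserves all conditions, both counts satisfy
  \<open>j(n+1) = j(n) + \<lfloor>n/2\<rfloor>\<close>.
\<close>

section \<open>Patterns of length three as inequalities between letters\<close>

lemma standardization_eq_triple:
  assumes "standardization w = [i, j, k]"
  obtains a b c where "w = [a, b, c]"
    "i < j \<longrightarrow> a < b" "j < k \<longrightarrow> b < c" "i < k \<longrightarrow> a < c"
    "j < i \<longrightarrow> b < a" "k < j \<longrightarrow> c < b" "k < i \<longrightarrow> c < a"
proof -
  define r where "r x = card {y \<in> set w. y \<le> x}" for x
  \<comment> \<open>Ranks are monotone in the letter, so a strictly smaller rank forces a strictly
    smaller letter. This carries the order of the pattern back to the word.\<close>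
  have r_less: "x < y" if "r x < r y" for x y
  proof (rule ccontr)
    assume "\<not> x < y"
    then have "r y \<le> r x" unfolding r_def by (intro card_mono) auto
    with that show False by simp
  qed
  have "map r w = standardization w"
    by (simp add: standardization_def r_def)
  with assms have "map r w = [i, j, k]" by simp
  then obtain a b c where "w = [a, b, c]" "r a = i" "r b = j" "r c = k"
    by (auto simp: map_eq_Cons_conv)
  with r_less show thesis by (intro that[of a b c]) auto
qed

lemma standardization_triple_simps:
  "a < b \<Longrightarrow> b < c \<Longrightarrow> standardization [a, b, c] = [1, 2, 3]"
  "c < a \<Longrightarrow> a < b \<Longrightarrow> standardization [a, b, c] = [2, 3, 1]"
  "b < c \<Longrightarrow> c < a \<Longrightarrow> standardization [a, b, c] = [3, 1, 2]"
  \<comment> \<open>Written as the set of a filtered list, each rank set of a concrete triple can be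
    evaluated, and so can its cardinality.\<close>
  unfolding standardization_def set_filter[symmetric] by simp_all

lemma avoids_123_iff:
  "avoids \<pi> [1, 2, 3] \<longleftrightarrow> (\<forall>a b c. subseq [a, b, c] \<pi> \<longrightarrow> \<not> (a < b \<and> b < c))"
proof -
  have "standardization w = [1, 2, 3] \<longleftrightarrow> (\<exists>a b c. w = [a, b, c] \<and> a < b \<and> b < c)" for w
  proof
    assume "standardization w = [1, 2, 3]"
    then show "\<exists>a b c. w = [a, b, c] \<and> a < b \<and> b < c"
      by (rule standardization_eq_triple) simp
  qed (use standardization_triple_simps(1) in blast)
  then show ?thesis unfolding avoids_def by metis
qed

lemma avoids_231_iff:
  "avoids \<pi> [2, 3, 1] \<longleftrightarrow> (\<forall>a b c. subseq [a, b, c] \<pi> \<longrightarrow> \<not> (c < a \<and> a < b))"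
proof -
  have "standardization w = [2, 3, 1] \<longleftrightarrow> (\<exists>a b c. w = [a, b, c] \<and> c < a \<and> a < b)" for w
  proof
    assume "standardization w = [2, 3, 1]"
    then show "\<exists>a b c. w = [a, b, c] \<and> c < a \<and> a < b"
      by (rule standardization_eq_triple) simp
  qed (use standardization_triple_simps(2) in blast)
  then show ?thesis unfolding avoids_def by metis
qed

lemma avoids_312_iff:
  "avoids \<pi> [3, 1, 2] \<longleftrightarrow> (\<forall>a b c. subseq [a, b, c] \<pi> \<longrightarrow> \<not> (b < c \<and> c < a))"
proof -
  have "standardization w = [3, 1, 2] \<longleftrightarrow> (\<exists>a b c. w = [a, b, c] \<and> b < c \<and> c < a)" for w
  proof
    assume "standardization w = [3, 1, 2]"
    then show "\<exists>a b c. w = [a, b, c] \<and> b < c \<and> c < a"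
      by (rule standardization_eq_triple) simp
  qed (use standardization_triple_simps(3) in blast)
  then show ?thesis unfolding avoids_def by metis
qed

section \<open>Short subwords and monotone words\<close>

lemma subseq_pair_Cons_iff:
  "subseq [a, b] (x # xs) \<longleftrightarrow> (a = x \<and> b \<in> set xs) \<or> subseq [a, b] xs"
  by (auto simp: subseq_singleton_left dest: subseq_Cons')

text \<open>A subword either uses the head or lies in the tail. This disjunction replaces the greedy
  case split of \<open>subseq_Cons2_iff\<close>, which is removed from the simpset in the inductions
  below.\<close>

lemma subseq_triple_Cons_iff:
  "subseq [a, b, c] (x # xs) \<longleftrightarrow> (a = x \<and> subseq [b, c] xs) \<or> subseq [a, b, c] xs"
  by (auto dest: subseq_Cons')

lemma subseq_pair_append_iff:
  "subseq [a, b] (xs @ ys) \<longleftrightarrow>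
     subseq [a, b] xs \<or> (a \<in> set xs \<and> b \<in> set ys) \<or> subseq [a, b] ys"
  by (induction xs) (auto simp: subseq_pair_Cons_iff simp del: subseq_Cons2_iff)

lemma subseq_triple_append_iff:
  "subseq [a, b, c] (xs @ ys) \<longleftrightarrow>
     subseq [a, b, c] xs \<or> (subseq [a, b] xs \<and> c \<in> set ys) \<or>
     (a \<in> set xs \<and> subseq [b, c] ys) \<or> subseq [a, b, c] ys"
  by (induction xs)
    (auto simp: subseq_pair_Cons_iff subseq_triple_Cons_iff subseq_pair_append_iff
      simp del: subseq_Cons2_iff)

lemma subseq_pairD:
  assumes "subseq [a, b] xs"
  shows "a \<in> set xs" "b \<in> set xs"
  using list_emb_set[OF assms, of a] list_emb_set[OF assms, of b] by auto

lemma subseq_map_right_iff: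
  "subseq xs (map f ys) \<longleftrightarrow> (\<exists>zs. xs = map f zs \<and> subseq zs ys)"
  by (auto simp: subseq_conv_nths nths_map)

text \<open>Distinctness turns every non-ascent into a descent. This is how avoidance of 123 will
  yield the two decreasing parts of a block permutation.\<close>

lemma strictly_decreasing_if_no_ascent:
  fixes xs :: "'a :: linorder list"
  assumes "distinct xs" "\<And>a b. subseq [a, b] xs \<Longrightarrow> \<not> a < b"
  shows "sorted_wrt (>) xs"
  using assms
proof (induction xs)
  case (Cons x xs)
  have "y < x" if "y \<in> set xs" for y
  proof -
    from that have "subseq [x, y] (x # xs)" unfolding subseq_pair_Cons_iff by blast
    then have "\<not> x < y" by (rule Cons.prems(2))
    moreover have "x \<noteq> y" using Cons.prems(1) that by auto
    ultimately show ?thesis by simp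
  qed
  moreover have "sorted_wrt (>) xs"
  proof (rule Cons.IH)
    show "\<not> a < b" if "subseq [a, b] xs" for a b
      using that by (intro Cons.prems(2)) (simp add: subseq_pair_Cons_iff del: subseq_Cons2_iff)
  qed (use Cons.prems(1) in simp)
  ultimately show ?case by simp
qed simp

lemma sorted_wrt_subseq_pairD: "sorted_wrt R xs \<Longrightarrow> subseq [a, b] xs \<Longrightarrow> R a b"
  by (induction xs) (auto simp: subseq_pair_Cons_iff simp del: subseq_Cons2_iff)

section \<open>The Jacobi condition for decreasing, concatenated and shifted words\<close>

lemma jacobi_Cons:
  "x \<notin> set xs \<Longrightarrow>
     jacobi (x # xs) \<longleftrightarrow> even (length (takeWhile (\<lambda>y. x < y) xs)) \<and> jacobi xs"
  \<comment> \<open>Letters of \<open>xs\<close> differ from \<open>x\<close>, so the search for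
    them skips the new head and their \<open>rho\<close> is unchanged.\<close>
  by (auto simp: jacobi_def rho_def)

lemma jacobi_decreasing: "sorted_wrt (>) xs \<Longrightarrow> jacobi xs"
proof (induction xs)
  case (Cons x xs)
  then have "takeWhile (\<lambda>y. x < y) xs = []" by (cases xs) auto
  with Cons show ?case by (subst jacobi_Cons) auto
qed (simp add: jacobi_def)

text \<open>Only the last letter of \<open>P\<close> has a run that can be nonempty, namely all of
  \<open>Q\<close>; every other letter is last or is followed at once by a smaller one.\<close>

lemma jacobi_decreasing_append_iff:
  assumes "sorted_wrt (>) P" "sorted_wrt (>) Q" "\<forall>p \<in> set P. \<forall>q \<in> set Q. p < q" "P \<noteq> []"
  shows "jacobi (P @ Q) \<longleftrightarrow> even (length Q)"
  using assms(4,1,3)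
proof (induction P rule: list_nonempty_induct)
  case (single x)
  then have "takeWhile (\<lambda>y. x < y) Q = Q" by simp
  moreover have "x \<notin> set Q" using single by auto
  ultimately show ?case
    using jacobi_decreasing[OF assms(2)] by (metis jacobi_Cons append_Cons append_Nil)
next
  case (cons x P)
  then have "takeWhile (\<lambda>y. x < y) (P @ Q) = []" by (cases P) auto
  with cons show ?case by (subst append_Cons, subst jacobi_Cons) auto
qed

text \<open>The final 1 is below every shifted letter, so it ends runs without lengthening them, and
  its own run is empty. Excluding 0 prevents a second occurrence of 1.\<close>

lemma jacobi_map_Suc_snoc:
  "distinct \<pi> \<Longrightarrow> 0 \<notin> set \<pi> \<Longrightarrow> jacobi (map Suc \<pi> @ [1]) \<longleftrightarrow> jacobi \<pi>"
proof (induction \<pi>)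
  case (Cons x \<pi>)
  have "takeWhile (\<lambda>y. Suc x < y) (map Suc \<pi> @ [1]) = map Suc (takeWhile (\<lambda>y. x < y) \<pi>)"
    by (induction \<pi>) auto
  with Cons show ?case by (simp add: jacobi_Cons image_iff)
qed (simp add: jacobi_def rho_def)

section \<open>Block permutations and their properties\<close>

definition block_perm :: "nat \<Rightarrow> nat \<Rightarrow> nat list" where
  "block_perm n x = rev [1..<Suc x] @ rev [Suc x..<Suc n]"

text \<open>Reversing each part gives a strictly increasing word on \<open>{1..n}\<close>, which is
  unique; the cut falls after \<open>length P\<close> letters.\<close>

lemma eq_block_perm_if_decreasing:
  assumes "P @ Q \<in> permutations_of_set {1..n}" "sorted_wrt (>) P" "sorted_wrt (>) Q"
    "\<forall>p \<in> set P. \<forall>q \<in> set Q. p < q"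
  shows "P @ Q = block_perm n (length P)" "length Q = n - length P" "length P \<le> n"
proof -
  have set_PQ: "set (P @ Q) = {1..n}" and dist: "distinct (P @ Q)"
    using permutations_of_setD[OF assms(1)] by blast+
  from distinct_card[OF dist] have len: "length P + length Q = n"
    unfolding set_PQ by simp
  then show "length Q = n - length P" "length P \<le> n" by auto
  have "sorted_wrt (<) (rev P @ rev Q)"
    using assms(2-4) by (simp add: sorted_wrt_append sorted_wrt_rev)
  moreover have "set (rev P @ rev Q) = set [1..<Suc n]"
    using set_PQ by (simp add: atLeastLessThanSuc_atLeastAtMost del: upt_Suc)
  ultimately have "rev P @ rev Q = [1..<Suc n]"
    by (intro strict_sorted_equal sorted_wrt_upt)
  also have "\<dots> = [1..<Suc (length P)] @ [Suc (length P)..<Suc n]"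
    using upt_add_eq_append[of 1 "Suc (length P)" "length Q"]
    unfolding add_Suc len by (simp del: upt_Suc)
  finally have "rev P = [1..<Suc (length P)] \<and> rev Q = [Suc (length P)..<Suc n]"
    by (rule iffD1[OF append_eq_append_conv, rotated]) (simp del: upt_Suc)
  then have "P = rev [1..<Suc (length P)]" "Q = rev [Suc (length P)..<Suc n]"
    unfolding rev_swap by blast+
  then show "P @ Q = block_perm n (length P)"
    unfolding block_perm_def by (rule arg_cong2)
qed

text \<open>Besides membership among the avoiders, this records both end letters: the head makes
  \<open>block_perm n\<close> injective, and the two ends separate blocks from words with a leading
  maximum or a final minimum.\<close>

lemma block_perm_props:
  assumes "1 \<le> x" "x < n"
  shows "block_perm n x \<in> permutations_of_set {1..n}"
    "hd (block_perm n x) = x" "last (block_perm n x) = Suc x"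
    "jacobi (block_perm n x) \<longleftrightarrow> even (n - x)"
    "avoids (block_perm n x) [1, 2, 3]"
    "avoids (block_perm n x) [2, 3, 1]"
    "avoids (block_perm n x) [3, 1, 2]"
proof -
  define P where "P = rev [1..<Suc x]"
  define Q where "Q = rev [Suc x..<Suc n]"
  have block: "block_perm n x = P @ Q" by (simp add: block_perm_def P_def Q_def)
  have dec: "sorted_wrt (>) P" "sorted_wrt (>) Q"
    unfolding P_def Q_def sorted_wrt_rev by (rule sorted_wrt_upt)+
  have sets: "set P = {1..x}" "set Q = {Suc x..n}"
    by (simp_all add: P_def Q_def atLeastLessThanSuc_atLeastAtMost del: upt_Suc)
  have "distinct P" "distinct Q"
    by (simp_all add: P_def Q_def del: upt_Suc)
  then show "block_perm n x \<in> permutations_of_set {1..n}"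
    unfolding block using sets assms by (intro permutations_of_setI) auto
  have "P = x # rev [1..<x]"
    using assms by (simp add: P_def)
  moreover have "Q = rev [Suc (Suc x)..<Suc n] @ [Suc x]"
    using assms by (simp add: Q_def upt_conv_Cons[of "Suc x"] del: upt_Suc)
  ultimately show "hd (block_perm n x) = x" "last (block_perm n x) = Suc x"
    by (simp_all add: block)
  have "jacobi (P @ Q) \<longleftrightarrow> even (length Q)"
    using dec sets assms by (intro jacobi_decreasing_append_iff) auto
  moreover have "length Q = n - x" by (simp add: Q_def del: upt_Suc)
  ultimately show "jacobi (block_perm n x) \<longleftrightarrow> even (n - x)"
    unfolding block by simp
  \<comment> \<open>The three alternatives are the patterns 321, 213 and 132. They arise from
    triples inside one part, with two letters in \<open>P\<close>, and with two letters in
    \<open>Q\<close>, so all three avoidance claims follow at once.\<close>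
  have triple: "(c < b \<and> b < a) \<or> (b < a \<and> a < c) \<or> (a < c \<and> c < b)"
    if "subseq [a, b, c] (P @ Q)" for a b c
  proof -
    have desc: "b < a \<and> c < b" if "sorted_wrt (>) xs" "subseq [a, b, c] xs" for xs
    proof -
      have "subseq [a, b] xs" "subseq [b, c] xs"
        by (rule subseq_order.trans[OF _ that(2)], simp)+
      then show ?thesis using sorted_wrt_subseq_pairD[OF that(1)] by simp
    qed
    from that consider "subseq [a, b, c] P" | "subseq [a, b] P" "c \<in> set Q"
      | "a \<in> set P" "subseq [b, c] Q" | "subseq [a, b, c] Q"
      by (auto simp: subseq_triple_append_iff)
    then show ?thesis
    proof cases
      case 1 then show ?thesis using desc[OF dec(1)] by simp
    next
      case 2
      then have "a \<in> set P" by (auto dest: subseq_pairD)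
      with 2 sets sorted_wrt_subseq_pairD[OF dec(1)] show ?thesis by fastforce
    next
      case 3
      then have "c \<in> set Q" by (auto dest: subseq_pairD)
      with 3 sets sorted_wrt_subseq_pairD[OF dec(2)] show ?thesis by fastforce
    next
      case 4 then show ?thesis using desc[OF dec(2)] by simp
    qed
  qed
  show "avoids (block_perm n x) [1, 2, 3]" "avoids (block_perm n x) [2, 3, 1]"
    "avoids (block_perm n x) [3, 1, 2]"
    unfolding block avoids_123_iff avoids_231_iff avoids_312_iff
    by (auto dest!: triple)
qed

section \<open>Counting and recognising Jacobi block permutations\<close>

definition jacobi_avoiders :: "nat \<Rightarrow> nat list set \<Rightarrow> nat list set" where
  "jacobi_avoiders n S =
     {\<pi> \<in> permutations_of_set {1..n}. jacobi \<pi> \<and> (\<forall>\<sigma> \<in> S. avoids \<pi> \<sigma>)}"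

definition jacobi_blocks :: "nat \<Rightarrow> nat list set" where
  "jacobi_blocks n = block_perm n ` {x. 1 \<le> x \<and> x < n \<and> even (n - x)}"

text \<open>The head recovers \<open>x\<close>, and \<open>Suc n - x\<close> runs through the
  positive even numbers up to \<open>n\<close>.\<close>

lemma card_jacobi_blocks: "card (jacobi_blocks (Suc n)) = n div 2"
proof -
  have "inj_on (block_perm (Suc n)) {x. 1 \<le> x \<and> x < Suc n \<and> even (Suc n - x)}"
    by (rule inj_on_inverseI[where g = hd]) (use block_perm_props(2) in auto)
  then have "card (jacobi_blocks (Suc n)) = card {x. 1 \<le> x \<and> x < Suc n \<and> even (Suc n - x)}"
    unfolding jacobi_blocks_def by (rule card_image)
  also have "{x. 1 \<le> x \<and> x < Suc n \<and> even (Suc n - x)} = (\<lambda>k. Suc n - 2 * k) ` {1..n div 2}"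
  proof (intro equalityI subsetI)
    fix x assume x: "x \<in> {x. 1 \<le> x \<and> x < Suc n \<and> even (Suc n - x)}"
    then have "even (Suc n - x)" by blast
    then obtain k where "Suc n - x = 2 * k" by (elim evenE)
    with x show "x \<in> (\<lambda>k. Suc n - 2 * k) ` {1..n div 2}"
      by (intro image_eqI[of _ _ k]) auto
  qed auto
  also have "card \<dots> = n div 2"
    by (subst card_image) (auto simp: inj_on_def)
  finally show ?thesis .
qed

text \<open>Common last step of both decompositions: nonempty parts put \<open>x = length P\<close>
  in the range from 1 to \<open>n - 1\<close>, and the Jacobi condition makes
  \<open>length Q = n - x\<close> even.\<close>

lemma in_jacobi_blocksI:
  assumes "P @ Q \<in> permutations_of_set {1..n}" "sorted_wrt (>) P" "sorted_wrt (>) Q"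
    "\<forall>p \<in> set P. \<forall>q \<in> set Q. p < q" "P \<noteq> []" "Q \<noteq> []" "jacobi (P @ Q)"
  shows "P @ Q \<in> jacobi_blocks n"
proof -
  note eq = eq_block_perm_if_decreasing[OF assms(1-4)]
  have "even (length Q)"
    using jacobi_decreasing_append_iff[OF assms(2-5)] assms(7) by simp
  moreover have "1 \<le> length P" "1 \<le> length Q"
    using assms(5,6) by (simp_all add: Suc_le_eq)
  ultimately show ?thesis
    unfolding jacobi_blocks_def using eq by (intro image_eqI[of _ _ "length P"]) auto
qed

lemma jacobi_blocks_subset:
  "\<sigma> \<in> {[2, 3, 1], [3, 1, 2]} \<Longrightarrow> jacobi_blocks n \<subseteq> jacobi_avoiders n {[1, 2, 3], \<sigma>}"
  using block_perm_props by (auto simp: jacobi_blocks_def jacobi_avoiders_def)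

lemma jacobi_avoiders_0: "\<sigma> \<noteq> [] \<Longrightarrow> jacobi_avoiders 0 {[1, 2, 3], \<sigma>} = {[]}"
  by (auto simp: jacobi_avoiders_def jacobi_def avoids_def standardization_def)

section \<open>Decomposition of the avoiders of 123 and 231\<close>

lemma Cons_max_in_jacobi_avoiders_231_iff:
  "Suc n # \<pi> \<in> jacobi_avoiders (Suc n) {[1, 2, 3], [2, 3, 1]} \<longleftrightarrow>
     \<pi> \<in> jacobi_avoiders n {[1, 2, 3], [2, 3, 1]}"
proof -
  have perm: "Suc n # \<pi> \<in> permutations_of_set {1..Suc n} \<longleftrightarrow> \<pi> \<in> permutations_of_set {1..n}"
  proof -
    have "insert (Suc n) (set \<pi>) = insert (Suc n) {1..n} \<longleftrightarrow> set \<pi> = {1..n}" if "Suc n \<notin> set \<pi>"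
      using that by (intro insert_ident) auto
    then show ?thesis
      by (auto simp: permutations_of_set_def atLeastAtMostSuc_conv)
  qed
  have "jacobi (Suc n # \<pi>) \<longleftrightarrow> jacobi \<pi>"
    "avoids (Suc n # \<pi>) [1, 2, 3] \<longleftrightarrow> avoids \<pi> [1, 2, 3]"
    "avoids (Suc n # \<pi>) [2, 3, 1] \<longleftrightarrow> avoids \<pi> [2, 3, 1]"
    if "\<pi> \<in> permutations_of_set {1..n}"
  proof -
    have less: "\<forall>y \<in> set \<pi>. y < Suc n"
      using that by (auto dest: permutations_of_setD)
    then have "takeWhile (\<lambda>y. Suc n < y) \<pi> = []" by (cases \<pi>) auto
    with less show "jacobi (Suc n # \<pi>) \<longleftrightarrow> jacobi \<pi>" by (subst jacobi_Cons) auto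
    \<comment> \<open>Both patterns begin with an ascent, so a leading maximum takes part in no
      occurrence.\<close>
    have "\<not> Suc n < b" if "subseq [b, c] \<pi>" for b c
      using less subseq_pairD[OF that] by auto
    then show "avoids (Suc n # \<pi>) [1, 2, 3] \<longleftrightarrow> avoids \<pi> [1, 2, 3]"
      "avoids (Suc n # \<pi>) [2, 3, 1] \<longleftrightarrow> avoids \<pi> [2, 3, 1]"
      unfolding avoids_123_iff avoids_231_iff subseq_triple_Cons_iff
      by blast+
  qed
  with perm show ?thesis unfolding jacobi_avoiders_def by auto
qed

text \<open>Let the first letter \<open>x\<close> differ from the maximum. Avoiding 231 forbids
  letters below \<open>x\<close> after the first letter above \<open>x\<close>, which splits the
  word into a low part \<open>P\<close> and a high part \<open>Q\<close>. An ascent in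
  \<open>P\<close> would extend to 123 by the maximum in \<open>Q\<close>, an ascent in
  \<open>Q\<close> by \<open>x\<close> in front.\<close>

lemma jacobi_avoiders_231_Suc:
  "jacobi_avoiders (Suc n) {[1, 2, 3], [2, 3, 1]} =
     (#) (Suc n) ` jacobi_avoiders n {[1, 2, 3], [2, 3, 1]} \<union> jacobi_blocks (Suc n)"
  (is "?A = ?B")
proof
  show "?B \<subseteq> ?A"
    using jacobi_blocks_subset Cons_max_in_jacobi_avoiders_231_iff by blast
  show "?A \<subseteq> ?B"
  proof
    fix \<pi> assume \<pi>: "\<pi> \<in> ?A"
    then have perm: "\<pi> \<in> permutations_of_set {1..Suc n}" and jac: "jacobi \<pi>"
      and "avoids \<pi> [1, 2, 3]" "avoids \<pi> [2, 3, 1]"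
      unfolding jacobi_avoiders_def by blast+
    then have av123: "\<And>a b c. subseq [a, b, c] \<pi> \<Longrightarrow> \<not> (a < b \<and> b < c)"
      and av231: "\<And>a b c. subseq [a, b, c] \<pi> \<Longrightarrow> \<not> (c < a \<and> a < b)"
      unfolding avoids_123_iff avoids_231_iff by blast+
    from perm have set: "set \<pi> = {1..Suc n}" and dist: "distinct \<pi>"
      by (rule permutations_of_setD)+
    then obtain x \<tau> where \<pi>_eq: "\<pi> = x # \<tau>" by (cases \<pi>) auto
    show "\<pi> \<in> ?B"
    proof (cases "x = Suc n")
      case True
      with \<pi> \<pi>_eq Cons_max_in_jacobi_avoiders_231_iff show ?thesis by blast
    next
      case False
      define P where "P = x # takeWhile (\<lambda>y. y < x) \<tau>"
      define Q where "Q = dropWhile (\<lambda>y. y < x) \<tau>"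
      have \<pi>_PQ: "\<pi> = P @ Q" by (simp add: \<pi>_eq P_def Q_def)
      have P_le: "p \<le> x" if "p \<in> set P" for p
        using that by (auto simp: P_def dest: set_takeWhileD)
      have max_Q: "Suc n \<in> set Q"
      proof -
        have "Suc n \<in> set (P @ Q)" using set \<pi>_PQ by auto
        moreover have "x \<le> Suc n" using set \<pi>_eq by auto
        ultimately show ?thesis using P_le False by fastforce
      qed
      \<comment> \<open>The first letter \<open>y\<close> of \<open>Q\<close> stopped the run of
        letters below \<open>x\<close>, so \<open>x < y\<close>; a later \<open>q < x\<close> would
        make \<open>x, y, q\<close> a 231.\<close>
      have x_less_Q: "x < q" if "q \<in> set Q" for q
      proof (cases Q)
        case (Cons y ys)
        have "\<not> y < x" using Cons unfolding Q_def by (metis dropWhile_eq_Cons_conv)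
        moreover have "x \<noteq> y" using dist \<pi>_PQ Cons by (auto simp: P_def)
        ultimately have "x < y" by simp
        show ?thesis
        proof (cases "q = y")
          case False
          with that Cons have "subseq [x, y, q] \<pi>"
            unfolding \<pi>_PQ subseq_triple_append_iff subseq_pair_Cons_iff
            by (auto simp: P_def subseq_singleton_left)
          from av231[OF this] \<open>x < y\<close> have "x \<le> q" by auto
          moreover have "x \<noteq> q" using dist \<pi>_PQ that by (auto simp: P_def)
          ultimately show ?thesis by simp
        qed (use \<open>x < y\<close> in simp)
      qed (use that in simp)
      have less: "\<forall>p \<in> set P. \<forall>q \<in> set Q. p < q"
        using P_le x_less_Q by fastforce
      have dec_P: "sorted_wrt (>) P"
      proof (rule strictly_decreasing_if_no_ascent)
        fix a b assume ab: "subseq [a, b] P"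
        with max_Q have "subseq [a, b, Suc n] \<pi>"
          by (auto simp: \<pi>_PQ subseq_triple_append_iff)
        moreover have "b \<in> set P" using ab by (rule subseq_pairD)
        ultimately show "\<not> a < b" using av123 less max_Q by blast
      qed (use dist \<pi>_PQ in auto)
      have dec_Q: "sorted_wrt (>) Q"
      proof (rule strictly_decreasing_if_no_ascent)
        fix a b assume ab: "subseq [a, b] Q"
        then have "subseq [x, a, b] \<pi>"
          by (auto simp: \<pi>_PQ subseq_triple_append_iff P_def)
        moreover have "a \<in> set Q" using ab by (rule subseq_pairD)
        ultimately show "\<not> a < b" using av123 x_less_Q by blast
      qed (use dist \<pi>_PQ in auto)
      have "P \<noteq> []" "Q \<noteq> []" using max_Q by (auto simp: P_def)
      then have "P @ Q \<in> jacobi_blocks (Suc n)"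
        using perm jac unfolding \<pi>_PQ
        by (intro in_jacobi_blocksI dec_P dec_Q less)
      then show ?thesis unfolding \<pi>_PQ by (rule UnI2)
    qed
  qed
qed

section \<open>Decomposition of the avoiders of 123 and 312\<close>

lemma snoc_min_in_jacobi_avoiders_312_iff:
  "map Suc \<pi> @ [1] \<in> jacobi_avoiders (Suc n) {[1, 2, 3], [3, 1, 2]} \<longleftrightarrow>
     \<pi> \<in> jacobi_avoiders n {[1, 2, 3], [3, 1, 2]}"
proof -
  have "{1..Suc n} = insert 1 (Suc ` {1..n})"
    by (auto simp: image_Suc_atLeastAtMost)
  then have perm:
    "map Suc \<pi> @ [1] \<in> permutations_of_set {1..Suc n} \<longleftrightarrow> \<pi> \<in> permutations_of_set {1..n}"
  proof -
    \<comment> \<open>Without 0 in the word, 1 lies outside both images and \<open>insert 1\<close>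
      can be cancelled.\<close>
    have "insert 1 (Suc ` set \<pi>) = insert 1 (Suc ` {1..n}) \<longleftrightarrow> set \<pi> = {1..n}" if "0 \<notin> set \<pi>"
    proof -
      have "1 \<notin> Suc ` set \<pi>" "1 \<notin> Suc ` {1..n}" using that by auto
      then show ?thesis by (metis insert_ident inj_image_eq_iff inj_Suc)
    qed
    moreover have "map Suc \<pi> @ [1] \<in> permutations_of_set {1..Suc n} \<longleftrightarrow>
        insert 1 (Suc ` set \<pi>) = {1..Suc n} \<and> distinct \<pi> \<and> 0 \<notin> set \<pi>"
      by (auto simp: permutations_of_set_def distinct_map)
    moreover have "\<pi> \<in> permutations_of_set {1..n} \<longleftrightarrow>
        set \<pi> = {1..n} \<and> distinct \<pi> \<and> 0 \<notin> set \<pi>"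
      by (auto simp: permutations_of_set_def)
    ultimately show ?thesis
      unfolding \<open>{1..Suc n} = insert 1 (Suc ` {1..n})\<close> by blast
  qed
  have subseq_Suc: "subseq [a, b, c] (map Suc \<pi>) \<longleftrightarrow>
      (\<exists>a' b' c'. a = Suc a' \<and> b = Suc b' \<and> c = Suc c' \<and> subseq [a', b', c'] \<pi>)" for a b c
    by (auto simp: subseq_map_right_iff Cons_eq_map_conv)
  have snoc: "subseq [a, b, c] (map Suc \<pi> @ [1]) \<longleftrightarrow>
      (\<exists>a' b' c'. a = Suc a' \<and> b = Suc b' \<and> c = Suc c' \<and> subseq [a', b', c'] \<pi>) \<or>
      (0 < a \<and> 0 < b \<and> c = 1 \<and> subseq [a, b] (map Suc \<pi>))" for a b c
    unfolding subseq_triple_append_iff subseq_Suc by (auto dest: subseq_pairD)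
  \<comment> \<open>\<open>R\<close> stands for the order condition of a pattern. It must be
    invariant under the shift and fail when the last letter is the minimum; 123 and 312 qualify
    because both end with an ascent.\<close>
  have avoids_iff: "(\<forall>a b c. subseq [a, b, c] (map Suc \<pi> @ [1]) \<longrightarrow> \<not> R a b c) \<longleftrightarrow>
      (\<forall>a b c. subseq [a, b, c] \<pi> \<longrightarrow> \<not> R a b c)"
    if "\<And>a b c. R (Suc a) (Suc b) (Suc c) \<longleftrightarrow> R a b c"
      and "\<And>a b. 0 < a \<Longrightarrow> 0 < b \<Longrightarrow> \<not> R a b 1"
    for R
    unfolding snoc using that by metis
  have "avoids (map Suc \<pi> @ [1]) [1, 2, 3] \<longleftrightarrow> avoids \<pi> [1, 2, 3]"
    "avoids (map Suc \<pi> @ [1]) [3, 1, 2] \<longleftrightarrow> avoids \<pi> [3, 1, 2]"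
    unfolding avoids_123_iff avoids_312_iff by (rule avoids_iff; simp)+
  moreover have "jacobi (map Suc \<pi> @ [1]) \<longleftrightarrow> jacobi \<pi>"
    if "\<pi> \<in> permutations_of_set {1..n}"
    using that by (intro jacobi_map_Suc_snoc) (auto dest: permutations_of_setD)
  ultimately show ?thesis
    using perm unfolding jacobi_avoiders_def by auto
qed

text \<open>Cut after the letter 1, assuming it is not last. A letter before 1 exceeding one after 1
  would form a 312 with it, so \<open>P\<close> lies below \<open>Q\<close>. Any letter of
  \<open>Q\<close> extends an ascent in \<open>P\<close> to 123, and the 1 extends an ascent in
  \<open>Q\<close>.\<close>

lemma jacobi_avoiders_312_Suc:
  "jacobi_avoiders (Suc n) {[1, 2, 3], [3, 1, 2]} =
     (\<lambda>\<pi>. map Suc \<pi> @ [1]) ` jacobi_avoiders n {[1, 2, 3], [3, 1, 2]} \<union> jacobi_blocks (Suc n)"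
  (is "?A = ?B")
proof
  show "?B \<subseteq> ?A"
    using jacobi_blocks_subset snoc_min_in_jacobi_avoiders_312_iff by blast
  show "?A \<subseteq> ?B"
  proof
    fix \<pi> assume \<pi>: "\<pi> \<in> ?A"
    then have perm: "\<pi> \<in> permutations_of_set {1..Suc n}" and jac: "jacobi \<pi>"
      and "avoids \<pi> [1, 2, 3]" "avoids \<pi> [3, 1, 2]"
      unfolding jacobi_avoiders_def by blast+
    then have av123: "\<And>a b c. subseq [a, b, c] \<pi> \<Longrightarrow> \<not> (a < b \<and> b < c)"
      and av312: "\<And>a b c. subseq [a, b, c] \<pi> \<Longrightarrow> \<not> (b < c \<and> c < a)"
      unfolding avoids_123_iff avoids_312_iff by blast+
    from perm have set: "set \<pi> = {1..Suc n}" and dist: "distinct \<pi>"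
      by (rule permutations_of_setD)+
    then have "1 \<in> set \<pi>" by simp
    then obtain S Q where \<pi>_eq: "\<pi> = S @ 1 # Q" by (meson split_list)
    have gt_1: "1 < y" if "y \<in> set S \<union> set Q" for y
    proof -
      have "y \<in> {1..Suc n}" using that set \<pi>_eq by auto
      moreover have "y \<noteq> 1" using that dist \<pi>_eq by auto
      ultimately show ?thesis by auto
    qed
    show "\<pi> \<in> ?B"
    proof (cases "Q = []")
      case True
      \<comment> \<open>All letters of \<open>S\<close> exceed 1, so truncated subtraction is undone
        by \<open>Suc\<close>; the lowered word is the required preimage.\<close>
      have "S = map Suc (map (\<lambda>y. y - 1) S)"
        using gt_1 by (auto intro!: map_idI[symmetric] simp: Suc_lessD)
      with True \<pi>_eq have "\<pi> = map Suc (map (\<lambda>y. y - 1) S) @ [1]" by simp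
      with \<pi> snoc_min_in_jacobi_avoiders_312_iff show ?thesis by blast
    next
      case False
      define P where "P = S @ [1]"
      have \<pi>_PQ: "\<pi> = P @ Q" by (simp add: \<pi>_eq P_def)
      have less: "\<forall>p \<in> set P. \<forall>q \<in> set Q. p < q"
      proof (intro ballI)
        fix p q assume p: "p \<in> set P" and q: "q \<in> set Q"
        show "p < q"
        proof (cases "p = 1")
          case False
          with p have "p \<in> set S" by (auto simp: P_def)
          with q have "subseq [p, 1, q] \<pi>"
            unfolding \<pi>_eq subseq_triple_append_iff by (simp add: subseq_singleton_left)
          from av312[OF this] gt_1[of q] q have "p \<le> q" by auto
          moreover have "p \<noteq> q" using dist p q \<pi>_PQ by auto
          ultimately show ?thesis by simp
        qed (use gt_1 q in auto)
      qed
      from False obtain z where z: "z \<in> set Q" by (cases Q) auto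
      have dec_P: "sorted_wrt (>) P"
      proof (rule strictly_decreasing_if_no_ascent)
        fix a b assume ab: "subseq [a, b] P"
        with z have "subseq [a, b, z] \<pi>"
          by (auto simp: \<pi>_PQ subseq_triple_append_iff)
        moreover have "b \<in> set P" using ab by (rule subseq_pairD)
        ultimately show "\<not> a < b" using av123 less z by blast
      qed (use dist \<pi>_PQ in auto)
      have dec_Q: "sorted_wrt (>) Q"
      proof (rule strictly_decreasing_if_no_ascent)
        fix a b assume ab: "subseq [a, b] Q"
        then have "subseq [1, a, b] \<pi>"
          by (auto simp: \<pi>_PQ subseq_triple_append_iff P_def)
        moreover have "a \<in> set Q" using ab by (rule subseq_pairD)
        ultimately show "\<not> a < b" using av123 gt_1 by blast
      qed (use dist \<pi>_PQ in auto)
      have "P \<noteq> []" "Q \<noteq> []" using False by (auto simp: P_def)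
      then have "P @ Q \<in> jacobi_blocks (Suc n)"
        using perm jac unfolding \<pi>_PQ
        by (intro in_jacobi_blocksI dec_P dec_Q less)
      then show ?thesis unfolding \<pi>_PQ by (rule UnI2)
    qed
  qed
qed

section \<open>The recurrence and its closed form\<close>

lemma card_jacobi_avoiders_Suc:
  assumes "\<sigma> \<in> {[2, 3, 1], [3, 1, 2]}"
  shows "card (jacobi_avoiders (Suc n) {[1, 2, 3], \<sigma>}) =
    card (jacobi_avoiders n {[1, 2, 3], \<sigma>}) + n div 2"
proof -
  have fin: "finite (jacobi_avoiders m S)" for m S
    by (simp add: jacobi_avoiders_def)
  have fin_blocks: "finite (jacobi_blocks m)" for m
    using finite_subset[OF jacobi_blocks_subset fin] by blast
  \<comment> \<open>\<open>f\<close> will be prepending the maximum or appending the minimum after a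
    shift.\<close>
  have card_eq: "card (f ` jacobi_avoiders n {[1, 2, 3], \<sigma>} \<union> jacobi_blocks (Suc n)) =
      card (jacobi_avoiders n {[1, 2, 3], \<sigma>}) + n div 2"
    if "inj f" "range f \<inter> jacobi_blocks (Suc n) = {}" for f
  proof -
    have "card (f ` jacobi_avoiders n {[1, 2, 3], \<sigma>} \<union> jacobi_blocks (Suc n)) =
        card (f ` jacobi_avoiders n {[1, 2, 3], \<sigma>}) + card (jacobi_blocks (Suc n))"
      using that(2) by (intro card_Un_disjoint) (auto simp: fin fin_blocks)
    then show ?thesis
      using that(1) by (simp add: card_image inj_on_subset card_jacobi_blocks)
  qed
  from assms consider "\<sigma> = [2, 3, 1]" | "\<sigma> = [3, 1, 2]" by auto
  then show ?thesis
  proof cases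
    case 1
    \<comment> \<open>The head of a block is \<open>x < Suc n\<close>.\<close>
    have "hd \<pi> \<noteq> Suc n" if "\<pi> \<in> jacobi_blocks (Suc n)" for \<pi>
      using that block_perm_props(2)[of _ "Suc n"] by (auto simp: jacobi_blocks_def)
    then have "range ((#) (Suc n)) \<inter> jacobi_blocks (Suc n) = {}" by force
    moreover have "inj ((#) (Suc n))" by (simp add: inj_def)
    ultimately show ?thesis
      using card_eq unfolding 1 jacobi_avoiders_231_Suc by blast
  next
    case 2
    \<comment> \<open>The last letter of a block is \<open>Suc x\<close> with
      \<open>1 \<le> x\<close>, hence at least 2.\<close>
    have "last \<pi> \<noteq> 1" if "\<pi> \<in> jacobi_blocks (Suc n)" for \<pi>
      using that block_perm_props(3)[of _ "Suc n"] by (auto simp: jacobi_blocks_def)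
    then have "range (\<lambda>\<pi>. map Suc \<pi> @ [1]) \<inter> jacobi_blocks (Suc n) = {}" by force
    moreover have "inj (\<lambda>\<pi>. map Suc \<pi> @ [1])"
      by (auto simp: inj_def inj_map_eq_map)
    ultimately show ?thesis
      using card_eq unfolding 2 jacobi_avoiders_312_Suc by blast
  qed
qed

lemma card_jacobi_avoiders:
  assumes "\<sigma> \<in> {[2, 3, 1], [3, 1, 2]}"
  shows "card (jacobi_avoiders n {[1, 2, 3], \<sigma>}) = 1 + (n - 1)\<^sup>2 div 4"
proof (induction n)
  case 0
  from assms have "\<sigma> \<noteq> []" by auto
  then show ?case by (subst jacobi_avoiders_0) simp_all
next
  case (Suc n)
  \<comment> \<open>For \<open>n = 2 * k\<close> with \<open>k > 0\<close> this reads
    \<open>(k*k - k) + k = k*k\<close>, and for \<open>n = 2 * k + 1\<close> it reads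
    \<open>k*k + k\<close>. At \<open>n = 0\<close> truncated subtraction makes both sides
    0.\<close>
  have "(n - 1)\<^sup>2 div 4 + n div 2 = n\<^sup>2 div 4"
  proof (cases "even n")
    case True
    then obtain k where "n = 2 * k" by (elim evenE)
    then show ?thesis by (cases k) (auto simp: power2_eq_square algebra_simps)
  next
    case False
    then obtain k where "n = 2 * k + 1" by (elim oddE)
    then show ?thesis by (auto simp: power2_eq_square algebra_simps)
  qed
  with Suc card_jacobi_avoiders_Suc[OF assms] show ?case by simp
qed

theorem theorem8p5:
  fixes n :: nat and \<sigma> :: "nat list"
  assumes "\<sigma> \<in> {[2, 3, 1], [3, 1, 2]}"
  shows "int (jacobi_count n {[1, 2, 3], \<sigma>}) = 1 + \<lfloor>(real n - 1)\<^sup>2 / 4\<rfloor>"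
proof -
  \<comment> \<open>Truncation matters only at \<open>n = 0\<close>: there the real quotient is 1/4,
    whose floor 0 agrees with the natural-number value.\<close>
  have "\<lfloor>(real n - 1)\<^sup>2 / 4\<rfloor> = int ((n - 1)\<^sup>2 div 4)"
  proof (cases n)
    case (Suc m)
    have "\<lfloor>real (m\<^sup>2) / real 4\<rfloor> = int (m\<^sup>2 div 4)"
      by (rule floor_divide_of_nat_eq)
    with Suc show ?thesis by simp
  qed (simp add: floor_eq_iff)
  moreover have "jacobi_count n {[1, 2, 3], \<sigma>} = card (jacobi_avoiders n {[1, 2, 3], \<sigma>})"
    by (simp add: jacobi_count_def jacobi_avoiders_def)
  ultimately show ?thesis
    using card_jacobi_avoiders[OF assms] by simp
qed

end
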